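(* Consider the single load minimal cache demand problem with $c$ cores and total cache $K$. Call a job large if $a_j>\frac12$ and small otherwise. Algorithm $A_{3/2}$: assign each large job to its own core (one large job per core); let $s_i$ be the resulting load of core $i$ and $r_i=1-s_i$; process the small jobs in non-increasing order of cache demand $x_j$ and assign them to the cores taken in non-increasing order of $r_i$, continuing on a core until its load exceeds $1$ and then moving to the next core; allocate to each core the maximum cache demand of the jobs assigned to it; fail if more than $c$ cores or more than $2K$ cache are used. If there is a cache partition and job assignment of makespan at most $1$ that use $c$ cores and $K$ cache, then $A_{3/2}$ finds a cache partition and job assignment that use at most $2K$ cache, at most $c$ cores and have makespan at most $\frac32$.
   Context: Single load minimal cache demand problem: each job $j$ has a load $a_j>0$ and a minimal cache demand $x_j\ge0$. A solution is a cache partition $p$ giving $p(i)\ge0$ cache to each core with total $\sum_ip(i)$ (the cache used), and an assignment $S$ of jobs to cores such that every job $j$ is assigned to a core with $p(S(j))\ge x_j$. The load of a core is the sum of $a_j$ over jobs assigned to it; the makespan is the maximum load. *)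

theory Defs
  imports Complex_Main
begin

text \<open>
  Jobs are the elements of a finite set \<open>J\<close>, with loads \<open>a\<close> and minimal cache demands \<open>x\<close>.
  The \<open>c\<close> available cores are the numbers below \<open>c\<close>. A cache partition \<open>p\<close> and an assignment \<open>S\<close>
  are total functions, of which only the values on cores below \<open>c\<close> and on jobs in \<open>J\<close> matter.
\<close>

definition solution :: "nat \<Rightarrow> 'j set \<Rightarrow> ('j \<Rightarrow> real) \<Rightarrow> (nat \<Rightarrow> real) \<Rightarrow> ('j \<Rightarrow> nat) \<Rightarrow> bool" where
  "solution c J x p S \<longleftrightarrow> (\<forall>i<c. 0 \<le> p i) \<and> (\<forall>j\<in>J. S j < c \<and> x j \<le> p (S j))"

definition cache_used :: "nat \<Rightarrow> (nat \<Rightarrow> real) \<Rightarrow> real" where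
  "cache_used c p = (\<Sum>i<c. p i)"

definition load :: "'j set \<Rightarrow> ('j \<Rightarrow> real) \<Rightarrow> ('j \<Rightarrow> nat) \<Rightarrow> nat \<Rightarrow> real" where
  "load J a S i = (\<Sum>j\<in>{j\<in>J. S j = i}. a j)"

text \<open>Loads are nonnegative, so inserting \<open>0\<close> only fixes the value for \<open>c = 0\<close>.\<close>

definition makespan :: "nat \<Rightarrow> 'j set \<Rightarrow> ('j \<Rightarrow> real) \<Rightarrow> ('j \<Rightarrow> nat) \<Rightarrow> real" where
  "makespan c J a S = Max (insert 0 (load J a S ` {..<c}))"

definition large :: "'j set \<Rightarrow> ('j \<Rightarrow> real) \<Rightarrow> 'j set" where
  "large J a = {j\<in>J. a j > 1/2}"

definition small :: "'j set \<Rightarrow> ('j \<Rightarrow> real) \<Rightarrow> 'j set" where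
  "small J a = {j\<in>J. \<not> a j > 1/2}"

text \<open>Demands are nonnegative, so inserting \<open>0\<close> only fixes the cache of cores without jobs.\<close>

definition max_demand :: "'j set \<Rightarrow> ('j \<Rightarrow> real) \<Rightarrow> ('j \<Rightarrow> nat) \<Rightarrow> nat \<Rightarrow> real" where
  "max_demand J x S i = Max (insert 0 (x ` {j\<in>J. S j = i}))"

text \<open>
  \<open>place_small a l js cs S\<close> extends the partial result \<open>S\<close>, with current core loads \<open>l\<close>, by the
  jobs \<open>js\<close>; the head of \<open>cs\<close> is the core being filled. It is left as soon as its load exceeds
  \<open>1\<close>, so the last job placed on it may overshoot. The result is \<open>None\<close> if a job remains when all
  cores have been left.
\<close>

fun place_small ::
  "('j \<Rightarrow> real) \<Rightarrow> (nat \<Rightarrow> real) \<Rightarrow> 'j list \<Rightarrow> nat list \<Rightarrow> ('j \<Rightarrow> nat) \<Rightarrow> ('j \<Rightarrow> nat) option" where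
  "place_small a l [] cs S = Some S"
| "place_small a l (j # js) [] S = None"
| "place_small a l (j # js) (i # cs) S =
     (if l i > 1 then place_small a l (j # js) cs S
      else place_small a (l(i := l i + a j)) js (i # cs) (S(j := i)))"

text \<open>
  The choices the algorithm leaves open: an injective placement \<open>L\<close> of the large jobs, and
  enumerations \<open>js\<close> of the small jobs and \<open>cs\<close> of the cores, with ties broken arbitrarily.
\<close>

definition A32_choice ::
  "nat \<Rightarrow> 'j set \<Rightarrow> ('j \<Rightarrow> real) \<Rightarrow> ('j \<Rightarrow> real) \<Rightarrow> ('j \<Rightarrow> nat) \<Rightarrow> 'j list \<Rightarrow> nat list \<Rightarrow> bool" where
  "A32_choice c J a x L js cs \<longleftrightarrow>
     (let s = load (large J a) a L; r = (\<lambda>i. 1 - s i) in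
        inj_on L (large J a) \<and> L ` large J a \<subseteq> {..<c} \<and>
        distinct js \<and> set js = small J a \<and> sorted_wrt (\<lambda>j k. x j \<ge> x k) js \<and>
        distinct cs \<and> set cs = {..<c} \<and> sorted_wrt (\<lambda>i k. r i \<ge> r k) cs)"

text \<open>
  \<open>A32 c K J a x res\<close> means that some run of the algorithm ends with \<open>res\<close>, where \<open>None\<close> is failure.
\<close>

inductive A32 ::
  "nat \<Rightarrow> real \<Rightarrow> 'j set \<Rightarrow> ('j \<Rightarrow> real) \<Rightarrow> ('j \<Rightarrow> real) \<Rightarrow>
   ((nat \<Rightarrow> real) \<times> ('j \<Rightarrow> nat)) option \<Rightarrow> bool"
  for c K J a x where
  too_many_large: "card (large J a) > c \<Longrightarrow> A32 c K J a x None"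
| no_core_left:
    "\<lbrakk>A32_choice c J a x L js cs;
      place_small a (load (large J a) a L) js cs L = None\<rbrakk> \<Longrightarrow> A32 c K J a x None"
| too_much_cache:
    "\<lbrakk>A32_choice c J a x L js cs;
      place_small a (load (large J a) a L) js cs L = Some S;
      cache_used c (max_demand J x S) > 2 * K\<rbrakk> \<Longrightarrow> A32 c K J a x None"
| success:
    "\<lbrakk>A32_choice c J a x L js cs;
      place_small a (load (large J a) a L) js cs L = Some S;
      cache_used c (max_demand J x S) \<le> 2 * K\<rbrakk> \<Longrightarrow> A32 c K J a x (Some (max_demand J x S, S))"

end

theory Submission
  imports Defs
begin

text \<open>
  Bound the final cache by the demands of the large jobs plus the largest small demand on each core.
  The first sum is at most \<open>K\<close>, because a solution of makespan at most \<open>1\<close> separates the large jobs.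
  For the second, let \<open>j\<close> be a small job on the \<open>k\<close>-th core of the order used by the algorithm
  (counting from \<open>0\<close>). The small jobs of demand at least \<open>x j\<close> have overfilled the \<open>k\<close> cores with the
  most remaining room, so any solution of makespan at most \<open>1\<close> needs more than \<open>k\<close> cores of cache
  at least \<open>x j\<close> for them. Choosing greedily a different such core for each \<open>k\<close> bounds the second
  sum by \<open>K\<close> as well.
\<close>

section \<open>Loads and demands\<close>

lemma sum_load:
  assumes "finite D" "finite I"
  shows "(\<Sum>i\<in>I. load D a S i) = (\<Sum>j\<in>{j\<in>D. S j \<in> I}. a j)"
proof -
  let ?E = "{j\<in>D. S j \<in> I}"
  have "(\<Sum>i\<in>I. load D a S i) = (\<Sum>i\<in>I. sum a {j\<in>?E. S j = i})"
    unfolding load_def by (rule sum.cong[OF refl], rule sum.cong) auto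
  also have "\<dots> = sum a ?E"
    using assms by (intro sum.group) auto
  finally show ?thesis .
qed

lemma load_cong: "(\<And>j. j \<in> D \<Longrightarrow> S j = T j) \<Longrightarrow> load D a S i = load D a T i"
  unfolding load_def by (rule sum.cong) auto

lemma large_Un_small: "large J a \<union> small J a = J"
  by (auto simp: large_def small_def)

lemma load_large_small:
  assumes "finite J"
  shows "load J a S i = load (large J a) a S i + load (small J a) a S i"
proof -
  have "{j\<in>J. S j = i} = {j\<in>large J a. S j = i} \<union> {j\<in>small J a. S j = i}"
    by (auto simp: large_def small_def)
  then show ?thesis
    unfolding load_def using assms
    by (simp only:, subst sum.union_disjoint) (auto simp: large_def small_def)
qed

lemma sum_cores_inj:
  fixes f :: "nat \<Rightarrow> real"
  assumes "inj_on S D" "S ` D \<subseteq> {..<c}"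
  shows "(\<Sum>i<c. f i) = (\<Sum>j\<in>D. f (S j)) + (\<Sum>i\<in>{..<c} - S ` D. f i)"
  using sum.subset_diff[OF assms(2), of f] assms(1) by (simp add: sum.reindex add.commute)

lemma load_inj:
  assumes "inj_on S D" "j \<in> D"
  shows "load D a S (S j) = a j"
proof -
  have "{k\<in>D. S k = S j} = {j}"
    using assms by (auto dest: inj_onD)
  then show ?thesis by (simp add: load_def)
qed

lemma load_outside: "i \<notin> S ` D \<Longrightarrow> load D a S i = 0"
  unfolding load_def by (rule sum.neutral) auto

text \<open>The right side does not depend on \<open>S\<close>: under an injective placement the
  nonempty cores carry exactly the loads \<open>a j\<close>, and the others carry \<open>0\<close>.
  So any two injective placements of the large jobs give the same sum.\<close>

lemma sum_load_inj:
  fixes g :: "real \<Rightarrow> real"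
  assumes "inj_on S D" "S ` D \<subseteq> {..<c}"
  shows "(\<Sum>i<c. g (load D a S i)) = (\<Sum>j\<in>D. g (a j)) + real (c - card D) * g 0"
proof -
  have "(\<Sum>i\<in>{..<c} - S ` D. g (load D a S i)) = (\<Sum>i\<in>{..<c} - S ` D. g 0)"
    by (rule sum.cong) (auto simp: load_outside)
  also have "\<dots> = real (c - card D) * g 0"
    using assms card_Diff_subset[of "S ` D" "{..<c}"]
    by (simp add: card_image finite_subset)
  finally show ?thesis
    using sum_cores_inj[OF assms, of "\<lambda>i. g (load D a S i)"] load_inj[OF assms(1)]
    by simp
qed

lemma load_le_makespan: "i < c \<Longrightarrow> load J a S i \<le> makespan c J a S"
  unfolding makespan_def by (rule Max_ge) auto

lemma makespan_le_iff: "makespan c J a S \<le> b \<longleftrightarrow> 0 \<le> b \<and> (\<forall>i<c. load J a S i \<le> b)"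
  unfolding makespan_def by auto

lemma le_load:
  assumes "finite J" "\<And>j. j \<in> J \<Longrightarrow> 0 < a j" "A \<subseteq> J" "\<And>j. j \<in> A \<Longrightarrow> S j = i"
  shows "sum a A \<le> load J a S i"
  unfolding load_def using assms by (intro sum_mono2) (auto intro: less_imp_le)

lemma max_demand_nonneg: "finite J \<Longrightarrow> 0 \<le> max_demand J x S i"
  unfolding max_demand_def by simp

lemma le_max_demand: "finite J \<Longrightarrow> j \<in> J \<Longrightarrow> x j \<le> max_demand J x S (S j)"
  unfolding max_demand_def by (rule Max_ge) auto

lemma max_demand_le_iff:
  "finite J \<Longrightarrow> max_demand J x S i \<le> b \<longleftrightarrow> 0 \<le> b \<and> (\<forall>j\<in>J. S j = i \<longrightarrow> x j \<le> b)"
  unfolding max_demand_def by auto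

lemma max_demand_cases:
  assumes "finite J"
  obtains "max_demand J x S i = 0" | j where "j \<in> J" "S j = i" "max_demand J x S i = x j"
  using Max_in[of "insert 0 (x ` {j\<in>J. S j = i})"] assms unfolding max_demand_def by auto

text \<open>Splits the cache of a core into a large and a small share; each share is later charged
  once to the cache of the given solution, whence the factor 2.\<close>

lemma max_demand_Un:
  assumes "finite D" "finite E"
  shows "max_demand (D \<union> E) x S i \<le> max_demand D x S i + max_demand E x S i"
proof -
  note nonneg = max_demand_nonneg[OF assms(1), of x S i] max_demand_nonneg[OF assms(2), of x S i]
  have "x j \<le> max_demand D x S (S j)" if "j \<in> D" for j
    using assms(1) that by (rule le_max_demand)
  moreover have "x j \<le> max_demand E x S (S j)" if "j \<in> E" for j
    using assms(2) that by (rule le_max_demand)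
  ultimately show ?thesis
    using nonneg assms by (subst max_demand_le_iff) (auto intro: add_increasing add_increasing2)
qed

lemma sum_max_demand_inj:
  assumes "finite D" "inj_on S D" "S ` D \<subseteq> {..<c}" "\<And>j. j \<in> D \<Longrightarrow> 0 \<le> x j"
  shows "(\<Sum>i<c. max_demand D x S i) \<le> sum x D"
proof -
  have "max_demand D x S (S j) \<le> x j" if "j \<in> D" for j
    using assms that by (subst max_demand_le_iff) (auto dest: inj_onD)
  then have "(\<Sum>j\<in>D. max_demand D x S (S j)) \<le> sum x D"
    by (rule sum_mono)
  moreover have "max_demand D x S i \<le> 0" if "i \<notin> S ` D" for i
    using assms(1) that by (subst max_demand_le_iff) auto
  then have "(\<Sum>i\<in>{..<c} - S ` D. max_demand D x S i) \<le> 0"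
    by (intro sum_nonpos) simp
  ultimately show ?thesis
    using sum_cores_inj[OF assms(2,3), of "max_demand D x S"] by simp
qed

section \<open>Comparing sums by distinct representatives\<close>

text \<open>Greedy choice: the \<open>k\<close> representatives picked before step \<open>k\<close>
  cannot exhaust a set of more than \<open>k\<close> elements.\<close>

lemma distinct_representatives:
  assumes "\<And>k. k < n \<Longrightarrow> k < card (Q k)"
  shows "\<exists>\<sigma>. inj_on \<sigma> {..<n} \<and> (\<forall>k<n. \<sigma> k \<in> Q k)"
  using assms
proof (induction n)
  case 0
  then show ?case by simp
next
  case (Suc n)
  then obtain \<sigma> where \<sigma>: "inj_on \<sigma> {..<n}" "\<forall>k<n. \<sigma> k \<in> Q k" by force
  have "card (\<sigma> ` {..<n}) < card (Q n)"
    using card_image[OF \<sigma>(1)] Suc.prems[of n] by simp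
  then obtain q where q: "q \<in> Q n" "q \<notin> \<sigma> ` {..<n}"
    by (metis card_mono finite_imageI finite_lessThan leD subsetI)
  then have "inj_on (\<sigma>(n := q)) {..<Suc n} \<and> (\<forall>k<Suc n. (\<sigma>(n := q)) k \<in> Q k)"
    using \<sigma> by (auto simp: inj_on_def less_Suc_eq)
  then show ?case by blast
qed

lemma sum_le_of_card_ge:
  fixes y p :: "nat \<Rightarrow> real"
  assumes "\<And>k. k < n \<Longrightarrow> k < card {i. i < n \<and> y k \<le> p i}" "\<And>i. i < n \<Longrightarrow> 0 \<le> p i"
  shows "(\<Sum>k<n. y k) \<le> (\<Sum>i<n. p i)"
proof -
  obtain \<sigma> where \<sigma>: "inj_on \<sigma> {..<n}" "\<forall>k<n. \<sigma> k \<in> {i. i < n \<and> y k \<le> p i}"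
    using distinct_representatives[of n "\<lambda>k. {i. i < n \<and> y k \<le> p i}"] assms(1) by blast
  have "(\<Sum>k<n. y k) \<le> (\<Sum>k<n. p (\<sigma> k))"
    using \<sigma>(2) by (intro sum_mono) auto
  also have "\<dots> = sum p (\<sigma> ` {..<n})"
    using \<sigma>(1) by (simp add: sum.reindex)
  also have "\<dots> \<le> (\<Sum>i<n. p i)"
    using \<sigma>(2) assms(2) by (intro sum_mono2) auto
  finally show ?thesis .
qed

section \<open>Placing the small jobs\<close>

text \<open>A core is left only once its load exceeds 1, so failure means that all cores exceed 1.
  The job that remains has positive load, which keeps the bound strict even for empty
  \<open>cs\<close>.\<close>

lemma place_small_None:
  assumes "place_small a l js cs S = None" "\<And>j. j \<in> set js \<Longrightarrow> 0 < a j" "distinct cs"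
  shows "real (length cs) < (\<Sum>i\<in>set cs. l i) + (\<Sum>j\<leftarrow>js. a j)"
  using assms
proof (induction a l js cs S rule: place_small.induct)
  case (2 a l j js S)
  have "0 \<le> sum_list (map a js)"
    using 2(2) by (intro sum_list_nonneg) (auto intro: less_imp_le)
  then show ?case
    using 2(2)[of j] by simp
next
  case (3 a l j js i cs S)
  \<comment> \<open>Distinctness puts \<open>i\<close> outside \<open>cs\<close>, so raising its
    load leaves the sum over the remaining cores unchanged.\<close>
  have [simp]: "(\<Sum>k\<in>set cs. if k = i then v else l k) = sum l (set cs)" for v
    using 3 by (intro sum.cong) auto
  show ?case
    using 3 by (cases "1 < l i") (auto simp: fun_upd_def)
qed auto

lemma place_small_other:
  "place_small a l js cs S = Some T \<Longrightarrow> j \<notin> set js \<Longrightarrow> T j = S j"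
  by (induction a l js cs S rule: place_small.induct) (auto split: if_splits)

lemma place_small_range:
  assumes "place_small a l js cs S = Some T" "distinct js" "j \<in> set js"
  shows "T j \<in> set cs"
  using assms
proof (induction a l js cs S rule: place_small.induct)
  case (3 a l k js i cs S)
  then show ?case
    using place_small_other[of a _ js "i # cs" "S(k := i)" T k]
    by (cases "1 < l i") fastforce+
qed auto

lemma load_insert:
  assumes "finite D" "j \<notin> D"
  shows "load (insert j D) a S i = (if S j = i then a j else 0) + load D a S i"
proof -
  have "{k \<in> insert j D. S k = i} = (if S j = i then insert j {k\<in>D. S k = i} else {k\<in>D. S k = i})"
    by auto
  then show ?thesis
    using assms by (simp add: load_def)
qed

text \<open>A core receives a job only while its load is at most 1, and the job adds at most 1/2.
  The initial loads are bounded by 3/2 rather than 1 so that the induction preserves the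
  hypothesis.\<close>

lemma place_small_load:
  assumes "place_small a l js cs S = Some T" "distinct js"
    "\<And>j. j \<in> set js \<Longrightarrow> a j \<le> 1/2" "\<And>i. l i \<le> 3/2"
  shows "l i + load (set js) a T i \<le> 3/2"
  using assms
proof (induction a l js cs S rule: place_small.induct)
  case (1 a l cs S)
  then show ?case by (simp add: load_def)
next
  case (3 a l k js i' cs S)
  show ?case
  proof (cases "1 < l i'")
    case True
    then show ?thesis using 3 by simp
  next
    case False
    have "T k = i'"
      using False 3 place_small_other[of a _ js "i' # cs" "S(k := i')" T k] by simp
    moreover have "(l(i' := l i' + a k)) i + load (set js) a T i \<le> 3/2"
    proof (rule 3(2)[OF False])
      show "place_small a (l(i' := l i' + a k)) js (i' # cs) (S(k := i')) = Some T"
        using 3(3) False by simp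
      show "(l(i' := l i' + a k)) m \<le> 3/2" for m
        using 3(5)[of k] 3(6)[of m] False by simp
    qed (use 3(4,5) in auto)
    ultimately show ?thesis
      using 3(4) by (simp add: load_insert split: if_splits)
  qed
qed auto

text \<open>Once a job lands on core \<open>k\<close>, all earlier cores have been left, hence are
  overfilled, and their jobs precede it in the order of demands.\<close>

lemma place_small_filled:
  assumes "place_small a l js cs S = Some T" "distinct js" "distinct cs"
    "sorted_wrt (\<lambda>j k. x j \<ge> x k) js" "\<And>j. j \<in> set js \<Longrightarrow> 0 < a j"
    "j \<in> set js" "k < length cs" "T j = cs ! k" "m < k"
  shows "1 < l (cs ! m) + load (set js) a T (cs ! m) \<and>
    (\<forall>j'\<in>set js. T j' = cs ! m \<longrightarrow> x j \<le> x j')"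
  using assms
proof (induction a l js cs S arbitrary: k m rule: place_small.induct)
  case (3 a l j1 js i cs S)
  obtain k' where k: "k = Suc k'" using 3(11) by (cases k) auto
  show ?case
  proof (cases "1 < l i")
    case True
    then have pl: "place_small a l (j1 # js) cs S = Some T" using 3 by simp
    show ?thesis
    proof (cases m)
      case 0
      \<comment> \<open>The core just left gets no further job, so its current load is
        final.\<close>
      have "T j' \<noteq> i" if "j' \<in> set (j1 # js)" for j'
        using place_small_range[OF pl 3(4) that] 3(5) by auto
      moreover from this have "load (set (j1 # js)) a T i = 0"
        by (intro load_outside) blast
      ultimately show ?thesis using True 0 by simp
    next
      case (Suc m')
      then show ?thesis
        using 3(1)[OF True pl, of k' m'] 3 k by simp
    qed
  next
    case False
    then have pl: "place_small a (l(i := l i + a j1)) js (i # cs) (S(j1 := i)) = Some T"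
      using 3 by simp
    have j1: "T j1 = i"
      using place_small_other[OF pl, of j1] 3(4) by simp
    \<comment> \<open>\<open>j1\<close> goes to the head of the core list, while \<open>j\<close>
      sits at a positive position; so \<open>j\<close> is still to be placed.\<close>
    have "j \<noteq> j1"
      using 3(5,9,10) k j1 by (metis Suc_less_eq distinct.simps(2) length_Cons nth_Cons_Suc nth_mem)
    then have "j \<in> set js" using 3(8) by simp
    then have
      "1 < (l(i := l i + a j1)) ((i # cs) ! m) + load (set js) a T ((i # cs) ! m) \<and>
       (\<forall>j'\<in>set js. T j' = (i # cs) ! m \<longrightarrow> x j \<le> x j')"
      using 3(4-11) \<open>j \<in> set js\<close> by (intro 3(2)[OF False pl]) auto
    then show ?thesis
      using j1 3(4,6) \<open>j \<in> set js\<close> by (auto simp: load_insert split: if_splits)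
  qed
qed auto

section \<open>The algorithm against a solution of makespan one\<close>

context
  fixes J :: "'j set" and a x :: "'j \<Rightarrow> real" and c :: nat
    and p :: "nat \<Rightarrow> real" and S :: "'j \<Rightarrow> nat"
  assumes fin: "finite J"
    and a_pos: "\<And>j. j \<in> J \<Longrightarrow> 0 < a j"
    and x_nonneg: "\<And>j. j \<in> J \<Longrightarrow> 0 \<le> x j"
    and sol: "solution c J x p S"
    and span: "makespan c J a S \<le> 1"
begin

section \<open>Consequences of a solution of makespan at most 1\<close>

lemma finite_large: "finite (large J a)" and finite_small: "finite (small J a)"
  using fin by (auto simp: large_def small_def)

lemma S_less: "j \<in> J \<Longrightarrow> S j < c" and p_ge: "j \<in> J \<Longrightarrow> x j \<le> p (S j)"
  and p_nonneg: "i < c \<Longrightarrow> 0 \<le> p i"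
  using sol by (auto simp: solution_def)

lemma load_le: "i < c \<Longrightarrow> load J a S i \<le> 1"
  using load_le_makespan span order_trans by blast

lemma job_le:
  assumes "j \<in> J"
  shows "a j \<le> 1"
  using le_load[of J a "{j}" S "S j"] load_le[OF S_less[OF assms]] fin a_pos assms by simp

text \<open>Two large jobs on one core would have total load above 1.\<close>

lemma inj_large: "inj_on S (large J a)"
proof (rule inj_onI, rule ccontr)
  fix j k assume jk: "j \<in> large J a" "k \<in> large J a" "S j = S k" "j \<noteq> k"
  then have "sum a {j, k} \<le> load J a S (S j)"
    using fin a_pos by (intro le_load) (auto simp: large_def)
  also have "\<dots> \<le> 1"
    using jk(1) S_less by (intro load_le) (simp add: large_def)
  finally show False using jk by (simp add: large_def)
qed

lemma S_large: "S ` large J a \<subseteq> {..<c}"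
  using S_less by (auto simp: large_def)

lemma card_large: "card (large J a) \<le> c"
  using card_inj_on_le[OF inj_large S_large] by simp

lemma sum_demand_large: "sum x (large J a) \<le> cache_used c p"
proof -
  have "sum x (large J a) \<le> (\<Sum>j\<in>large J a. p (S j))"
    using p_ge by (intro sum_mono) (auto simp: large_def)
  also have "\<dots> \<le> cache_used c p"
    using sum_cores_inj[OF inj_large S_large, of p]
      sum_nonneg[of "{..<c} - S ` large J a" p] p_nonneg
    by (simp add: cache_used_def)
  finally show ?thesis .
qed

lemma total_load: "sum a J \<le> c"
proof -
  have "sum a J = (\<Sum>i<c. load J a S i)"
    using S_less by (subst sum_load[OF fin]) (auto intro: sum.cong)
  also have "\<dots> \<le> c"
    using sum_mono[of "{..<c}" "load J a S" "\<lambda>_. 1"] load_le by simp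
  finally show ?thesis .
qed

lemma choice_exists: "\<exists>L js cs. A32_choice c J a x L js cs"
proof -
  let ?r = "\<lambda>i. load (large J a) a S i"
  obtain js0 where js0: "set js0 = small J a" "distinct js0"
    using finite_distinct_list[OF finite_small] by blast
  let ?js = "sort_key (\<lambda>j. - x j) js0" and ?cs = "sort_key ?r [0..<c]"
  have "sorted_wrt (\<lambda>j k. x j \<ge> x k) ?js" "sorted_wrt (\<lambda>i k. 1 - ?r i \<ge> 1 - ?r k) ?cs"
    using sorted_sort_key[of "\<lambda>j. - x j" js0] sorted_sort_key[of ?r "[0..<c]"]
    by (auto simp: sorted_wrt_map)
  \<comment> \<open>The given assignment \<open>S\<close> itself serves as the placement of the
    large jobs.\<close>
  then have "A32_choice c J a x S ?js ?cs"
    using js0 inj_large S_large by (auto simp: A32_choice_def Let_def)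
  then show ?thesis by blast
qed

context
  fixes L :: "'j \<Rightarrow> nat" and js :: "'j list" and cs :: "nat list"
  assumes choice: "A32_choice c J a x L js cs"
begin

section \<open>Arbitrary choices never run out of cores\<close>

lemma inj_L: "inj_on L (large J a)" and L_large: "L ` large J a \<subseteq> {..<c}"
  and distinct_js: "distinct js" and set_js: "set js = small J a"
  and sorted_js: "sorted_wrt (\<lambda>j k. x j \<ge> x k) js"
  and distinct_cs: "distinct cs" and set_cs: "set cs = {..<c}"
  and sorted_cs:
    "sorted_wrt (\<lambda>i k. 1 - load (large J a) a L i \<ge> 1 - load (large J a) a L k) cs"
  using choice by (auto simp: A32_choice_def Let_def)

lemma length_cs: "length cs = c"
  using distinct_card[OF distinct_cs] set_cs by simp

lemma load_L_le: "load (large J a) a L i \<le> 1"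
proof (cases "i \<in> L ` large J a")
  case True
  then show ?thesis
    using load_inj[OF inj_L, of _ a] job_le by (auto simp: large_def)
next
  case False
  then show ?thesis by (simp add: load_outside)
qed

text \<open>Failure would force a total load above \<open>c\<close>, but the given solution bounds
  it by \<open>c\<close>.\<close>

lemma place_small_succeeds: "place_small a (load (large J a) a L) js cs L \<noteq> None"
proof
  assume "place_small a (load (large J a) a L) js cs L = None"
  then have "real c < (\<Sum>i<c. load (large J a) a L i) + (\<Sum>j\<leftarrow>js. a j)"
    using place_small_None[of a _ js cs L] a_pos distinct_cs set_js
    by (fastforce simp: small_def length_cs set_cs)
  also have "(\<Sum>j\<leftarrow>js. a j) = sum a (small J a)"
    using distinct_js set_js by (simp add: sum_list_distinct_conv_sum_set)
  also have "(\<Sum>i<c. load (large J a) a L i) = sum a (large J a)"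
    using sum_load_inj[OF inj_L L_large, of "\<lambda>v. v" a] by simp
  also have "sum a (large J a) + sum a (small J a) = sum a J"
    using sum.union_disjoint[OF finite_large finite_small, of a] large_Un_small[of J a]
    by (simp add: large_def small_def disjoint_iff)
  finally show False using total_load by simp
qed

context
  fixes T :: "'j \<Rightarrow> nat"
  assumes placed: "place_small a (load (large J a) a L) js cs L = Some T"
begin

section \<open>Makespan and cache of the assignment produced\<close>

lemma T_large: "j \<in> large J a \<Longrightarrow> T j = L j"
  using place_small_other[OF placed] set_js by (auto simp: large_def small_def)

lemma T_less:
  assumes "j \<in> J"
  shows "T j < c"
proof (cases "j \<in> large J a")
  case True
  then show ?thesis using T_large L_large by auto
next
  case False
  then have "j \<in> set js" using assms set_js by (auto simp: large_def small_def)
  then show ?thesis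
    using place_small_range[OF placed distinct_js] set_cs by auto
qed

lemma makespan_T: "makespan c J a T \<le> 3/2"
proof -
  have "load J a T i \<le> 3/2" for i
  proof -
    have "load (large J a) a L i + load (set js) a T i \<le> 3/2"
    proof (rule place_small_load[OF placed distinct_js])
      show "load (large J a) a L i \<le> 3/2" for i
        using load_L_le[of i] by simp
    qed (simp add: set_js small_def)
    then show ?thesis
      using load_large_small[OF fin, of a T i] load_cong[of "large J a" T L a i] T_large set_js
      by simp
  qed
  then show ?thesis by (subst makespan_le_iff) simp
qed

text \<open>
  The room in the \<open>k\<close> cores preferred by the algorithm is compared with the room in at most \<open>k\<close>
  other cores without matching the cores: with the threshold \<open>t\<close> below, both reduce to the sum of
  \<open>max 0 (r i - t)\<close> over all cores, which depends only on the loads of the large jobs.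
\<close>

lemma enough_cache_cores:
  assumes j: "j \<in> small J a" and k: "k < c" "T j = cs ! k"
  shows "k < card {i. i < c \<and> x j \<le> p i}"
proof (rule ccontr)
  let ?s = "load (large J a) a L" and ?Q = "{i. i < c \<and> x j \<le> p i}"
  let ?A = "{j'\<in>small J a. x j \<le> x j'}"
  assume "\<not> k < card ?Q"
  then have card: "card ?Q \<le> k" by simp
  \<comment> \<open>The room on the core of \<open>j\<close>: cores before position \<open>k\<close>
    have room at least \<open>t\<close>, later ones at most \<open>t\<close>.\<close>
  define t where "t = 1 - ?s (cs ! k)"
  have t: "0 \<le> t" using load_L_le by (simp add: t_def)
  define h where "h v = max 0 (1 - v - t)" for v :: real
  have anti: "?s (cs ! m) \<le> ?s (cs ! n)" if "m \<le> n" "n < c" for m n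
    using sorted_wrt_nth_less[OF sorted_cs, of m n] that length_cs by (cases "m = n") auto
  have inj: "inj_on ((!) cs) {..<c}"
    using distinct_cs length_cs by (intro inj_on_nth) auto

  let ?F = "(!) cs ` {..<k}"
  have filled: "1 < ?s (cs ! m) + load (small J a) a T (cs ! m) \<and>
      (\<forall>j'\<in>small J a. T j' = cs ! m \<longrightarrow> x j \<le> x j')" if "m < k" for m
    using place_small_filled[OF placed distinct_js distinct_cs sorted_js _ _ _ k(2) that]
      j k(1) a_pos by (auto simp: set_js length_cs small_def)
  have jF: "T j \<notin> ?F"
    using inj k by (auto dest: inj_onD)
  have "(\<Sum>m<k. 1 - ?s (cs ! m)) \<le> (\<Sum>m<k. load (small J a) a T (cs ! m))"
    using filled by (intro sum_mono) force
  also have "\<dots> = (\<Sum>i\<in>?F. load (small J a) a T i)"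
    using inj_on_subset[OF inj, of "{..<k}"] k(1) by (simp add: sum.reindex)
  also have "\<dots> = sum a {j'\<in>small J a. T j' \<in> ?F}"
    by (rule sum_load[OF finite_small]) simp
  \<comment> \<open>The job \<open>j\<close> lies outside the first \<open>k\<close> cores, and its
    positive load makes the chain strict.\<close>
  also have "\<dots> < sum a (insert j {j'\<in>small J a. T j' \<in> ?F})"
    using jF j a_pos[of j] fin by (subst sum.insert) (auto simp: small_def)
  also have "\<dots> \<le> sum a ?A"
    using filled j a_pos fin
    by (intro sum_mono2) (auto simp: small_def intro: less_imp_le)
  \<comment> \<open>The given solution must put every job of demand at least \<open>x j\<close> on a
    core of \<open>?Q\<close>.\<close>
  also have "\<dots> \<le> sum a {j'\<in>small J a. S j' \<in> ?Q}"
    using S_less p_ge a_pos fin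
    by (intro sum_mono2) (auto simp: small_def intro: less_imp_le order_trans)
  also have "\<dots> = (\<Sum>i\<in>?Q. load (small J a) a S i)"
    using sum_load[OF finite_small, of ?Q a S] by simp
  also have "\<dots> \<le> (\<Sum>i\<in>?Q. h (load (large J a) a S i) + t)"
    using load_le load_large_small[OF fin, of a S] by (intro sum_mono) (force simp: h_def)
  also have "\<dots> = (\<Sum>i\<in>?Q. h (load (large J a) a S i)) + card ?Q * t"
    by (simp add: sum.distrib)
  \<comment> \<open>Since \<open>h\<close> is nonnegative the sum may run over all cores;
    \<open>card ?Q\<close> may grow to \<open>k\<close> because \<open>t\<close> is
    nonnegative.\<close>
  also have "\<dots> \<le> (\<Sum>i<c. h (load (large J a) a S i)) + k * t"
    using card t by (intro add_mono sum_mono2 mult_right_mono) (auto simp: h_def)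
  also have "(\<Sum>i<c. h (load (large J a) a S i)) = (\<Sum>i<c. h (?s i))"
    by (simp add: sum_load_inj[OF inj_large S_large] sum_load_inj[OF inj_L L_large])
  also have "\<dots> = (\<Sum>m<c. h (?s (cs ! m)))"
  proof -
    have "(!) cs ` {..<c} = {..<c}"
      using set_cs length_cs by (auto simp: set_conv_nth)
    then show ?thesis using sum.reindex[OF inj, of "\<lambda>i. h (?s i)"] by simp
  qed
  \<comment> \<open>From position \<open>k\<close> on the room is at most \<open>t\<close>, so
    \<open>h\<close> vanishes; before it the maximum is attained by the room minus \<open>t\<close>,
    and the \<open>k\<close> copies of \<open>t\<close> then cancel.\<close>
  also have "\<dots> = (\<Sum>m<k. h (?s (cs ! m)))"
    using anti k(1) by (intro sum.mono_neutral_right) (auto simp: h_def t_def)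
  also have "\<dots> = (\<Sum>m<k. 1 - ?s (cs ! m) - t)"
    using anti k(1) by (intro sum.cong) (auto simp: h_def t_def)
  also have "\<dots> + k * t = (\<Sum>m<k. 1 - ?s (cs ! m))"
    by (simp add: sum_subtractf)
  finally show False by simp
qed

lemma sum_demand_small: "(\<Sum>i<c. max_demand (small J a) x T i) \<le> cache_used c p"
proof -
  let ?y = "\<lambda>k. max_demand (small J a) x T (cs ! k)"
  have inj: "inj_on ((!) cs) {..<c}"
    using distinct_cs length_cs by (intro inj_on_nth) auto
  have "k < card {i. i < c \<and> ?y k \<le> p i}" if k: "k < c" for k
  proof (cases rule: max_demand_cases[OF finite_small, of x T "cs ! k"])
    case 1
    \<comment> \<open>Without a positive demand every core qualifies, and there are
      \<open>c > k\<close> of them.\<close>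
    then have "{i. i < c \<and> ?y k \<le> p i} = {..<c}"
      using p_nonneg by auto
    then show ?thesis using k by simp
  next
    case (2 j)
    then show ?thesis using enough_cache_cores[OF 2(1) k 2(2)] by simp
  qed
  then have "(\<Sum>k<c. ?y k) \<le> cache_used c p"
    unfolding cache_used_def using p_nonneg by (rule sum_le_of_card_ge)
  moreover have "(!) cs ` {..<c} = {..<c}"
    using set_cs length_cs by (auto simp: set_conv_nth)
  ultimately show ?thesis
    using sum.reindex[OF inj, of "max_demand (small J a) x T"] by simp
qed

lemma cache_T: "cache_used c (max_demand J x T) \<le> 2 * cache_used c p"
proof -
  have "inj_on T (large J a)" "T ` large J a \<subseteq> {..<c}"
    using inj_L L_large T_large by (auto simp: inj_on_def image_subset_iff)
  then have "(\<Sum>i<c. max_demand (large J a) x T i) \<le> sum x (large J a)"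
    using x_nonneg finite_large by (intro sum_max_demand_inj) (auto simp: large_def)
  also note sum_demand_large
  finally have *: "(\<Sum>i<c. max_demand (large J a) x T i) \<le> cache_used c p" .
  have "cache_used c (max_demand J x T) \<le>
      (\<Sum>i<c. max_demand (large J a) x T i + max_demand (small J a) x T i)"
    unfolding cache_used_def
    using max_demand_Un[OF finite_large finite_small, of x T]
    by (intro sum_mono) (simp add: large_Un_small)
  then show ?thesis
    using * sum_demand_small by (simp add: sum.distrib)
qed

lemma solution_T: "solution c J x (max_demand J x T) T"
  using T_less max_demand_nonneg[OF fin] le_max_demand[OF fin] by (auto simp: solution_def)

end

end

end

text \<open>Runs form a relation because the algorithm leaves choices open. The claim for all runs
  is therefore paired with the existence of a run, which keeps it from being vacuous.\<close>

theorem theorem6: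
  fixes J :: "'j set" and a x :: "'j \<Rightarrow> real" and c :: nat and K :: real
  assumes "finite J"
    and "\<And>j. j \<in> J \<Longrightarrow> a j > 0"
    and "\<And>j. j \<in> J \<Longrightarrow> x j \<ge> 0"
    and "\<exists>p S. solution c J x p S \<and> cache_used c p \<le> K \<and> makespan c J a S \<le> 1"
  shows "(\<exists>res. A32 c K J a x res) \<and>
         (\<forall>res. A32 c K J a x res \<longrightarrow>
            (\<exists>p S. res = Some (p, S) \<and> solution c J x p S \<and>
                   cache_used c p \<le> 2 * K \<and> makespan c J a S \<le> 3 / 2))"
proof -
  obtain p S where opt: "solution c J x p S" "cache_used c p \<le> K" "makespan c J a S \<le> 1"
    using assms(4) by blast
  note ctxt = assms(1-3) opt(1,3)
  obtain L js cs where choice: "A32_choice c J a x L js cs"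
    using choice_exists[OF ctxt] by blast
  obtain T where T: "place_small a (load (large J a) a L) js cs L = Some T"
    using place_small_succeeds[OF ctxt choice] by blast
  \<comment> \<open>Stated for arbitrary choices, since a run need not use the ones obtained
    above.\<close>
  have cache: "cache_used c (max_demand J x T) \<le> 2 * K"
    if "A32_choice c J a x L js cs" "place_small a (load (large J a) a L) js cs L = Some T"
    for L js cs T
    using cache_T[OF ctxt that] opt(2) by simp
  have "\<exists>p S. res = Some (p, S) \<and> solution c J x p S \<and>
      cache_used c p \<le> 2 * K \<and> makespan c J a S \<le> 3 / 2" if "A32 c K J a x res" for res
    using that
  proof cases
    case too_many_large
    then show ?thesis using card_large[OF ctxt] by simp
  next
    case (no_core_left L js cs)
    then show ?thesis using place_small_succeeds[OF ctxt] by blast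
  next
    case (too_much_cache L js cs T)
    then show ?thesis using cache by fastforce
  next
    case (success L js cs T)
    then show ?thesis using solution_T[OF ctxt] makespan_T[OF ctxt] by blast
  qed
  then show ?thesis
    using A32.success[OF choice T cache[OF choice T]] by blast
qed

end
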